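(* Let $d_{\mathrm{ff}},d_{\mathrm{model}}\ge1$ be integers, let $W_{\mathrm{gate}},W_{\mathrm{up}}\in\mathbb{R}^{d_{\mathrm{ff}}\times d_{\mathrm{model}}}$ and $W_{\mathrm{down}}\in\mathbb{R}^{d_{\mathrm{model}}\times d_{\mathrm{ff}}}$, and let $\sigma\colon\mathbb{R}\to\mathbb{R}$ be a function applied coordinatewise to vectors. For $x\in\mathbb{R}^{d_{\mathrm{model}}}$ define $$\mathrm{SwiGLU}(x;W_{\mathrm{gate}},W_{\mathrm{up}},W_{\mathrm{down}})=W_{\mathrm{down}}\bigl(\sigma(W_{\mathrm{gate}}x)\odot(W_{\mathrm{up}}x)\bigr).$$ Let $P$ be a $d_{\mathrm{ff}}\times d_{\mathrm{ff}}$ permutation matrix, and define $\widetilde W_{\mathrm{gate}}=PW_{\mathrm{gate}}$, $\widetilde W_{\mathrm{up}}=PW_{\mathrm{up}}$, $\widetilde W_{\mathrm{down}}=W_{\mathrm{down}}P^\top$. Then, for every $x\in\mathbb{R}^{d_{\mathrm{model}}}$, $$\mathrm{SwiGLU}(x;\widetilde W_{\mathrm{gate}},\widetilde W_{\mathrm{up}},\widetilde W_{\mathrm{down}})=\mathrm{SwiGLU}(x;W_{\mathrm{gate}},W_{\mathrm{up}},W_{\mathrm{down}}).$$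
   Context: $\odot$ denotes the Hadamard (entrywise) product of vectors. *)

theory Defs
  imports "HOL-Analysis.Analysis"
begin

(* The type class product on "real ^ 'n" is entrywise (times_vec_def), i.e. the Hadamard product. *)
definition swiglu ::
  "(real \<Rightarrow> real) \<Rightarrow> real ^ 'model ^ 'ff \<Rightarrow> real ^ 'model ^ 'ff \<Rightarrow> real ^ 'ff ^ 'model
    \<Rightarrow> real ^ 'model \<Rightarrow> real ^ 'model"
  where
  "swiglu \<sigma> W_gate W_up W_down x =
     W_down *v ((\<chi> i. \<sigma> ((W_gate *v x) $ i)) * (W_up *v x))"

definition permutation_matrix :: "real ^ 'n ^ 'n \<Rightarrow> bool"
  where
  "permutation_matrix P \<longleftrightarrow>
     (\<exists>p. p permutes (UNIV :: 'n set) \<and> P = (\<chi> i j. if j = p i then 1 else 0))"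

end

theory Submission
  imports Defs
begin

text \<open>Multiplying by \<open>P\<close> merely relabels coordinates, y to (y_(p i))_i, and both
  \<sigma> and the Hadamard product act coordinate by coordinate, so they commute with relabelling.
  Hence permuting the rows of both input matrices turns the hidden vector h into P h, and the factor
  \<open>transpose P\<close> absorbed into \<open>W_down\<close> undoes this, since P^T P = I. The
  two lemmas give the action of \<open>P\<close> and its inversion by the transpose.\<close>

lemma permutation_matrix_vector_mult:
  "(\<chi> i j. if j = p i then 1 else 0) *v y = (\<chi> i. y $ p i)" for y :: "real ^ 'n"
  by (simp add: vec_eq_iff matrix_vector_mult_def if_distrib[of "\<lambda>a. a * _"] cong: if_cong)

text \<open>This is P^T (P y) = y with P y already evaluated. Reindexing the sum for coordinate k
  along the bijection \<open>p\<close> leaves a sum with y $ k as its only surviving term.\<close>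

lemma transpose_permutation_matrix_vector_mult:
  fixes y :: "real ^ 'n"
  assumes "p permutes (UNIV :: 'n set)"
  shows "transpose (\<chi> i j. if j = p i then 1 else 0) *v (\<chi> i. y $ p i) = y"
proof -
  have "(\<Sum>i\<in>UNIV. (if k = p i then 1 else 0) * y $ p i) = y $ k" for k
  proof -
    have "(\<Sum>i\<in>UNIV. (if k = p i then 1 else 0) * y $ p i)
        = (\<Sum>i\<in>UNIV. (if k = i then 1 else 0) * y $ i)"
      using sum.permute[OF assms, of "\<lambda>i. (if k = i then 1 else 0) * y $ i"]
      by (simp add: o_def)
    then show ?thesis
      by (simp add: if_distrib[of "\<lambda>a. a * _"] cong: if_cong)
  qed
  then show ?thesis
    by (simp add: vec_eq_iff matrix_vector_mult_def transpose_def)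
qed

theorem proposition3p4:
  fixes \<sigma> :: "real \<Rightarrow> real"
    and W_gate W_up :: "real ^ 'model ^ 'ff"
    and W_down :: "real ^ 'ff ^ 'model"
    and P :: "real ^ 'ff ^ 'ff"
  assumes "permutation_matrix P"
  shows "\<forall>x :: real ^ 'model.
    swiglu \<sigma> (P ** W_gate) (P ** W_up) (W_down ** transpose P) x
      = swiglu \<sigma> W_gate W_up W_down x"
proof
  fix x :: "real ^ 'model"
  obtain p where p: "p permutes (UNIV :: 'ff set)" and P: "P = (\<chi> i j. if j = p i then 1 else 0)"
    using assms unfolding permutation_matrix_def by blast
  define h where "h = (\<chi> i. \<sigma> ((W_gate *v x) $ i)) * (W_up *v x)"
  \<comment> \<open>Associativity read backwards exposes P (W x), so entry i of both factors is the
    old entry at \<open>p i\<close>, and so is their product.\<close>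
  have "(\<chi> i. \<sigma> (((P ** W_gate) *v x) $ i)) * ((P ** W_up) *v x) = (\<chi> i. h $ p i)"
    by (simp add: P h_def vec_eq_iff permutation_matrix_vector_mult
        flip: matrix_vector_mul_assoc)
  then have "swiglu \<sigma> (P ** W_gate) (P ** W_up) (W_down ** transpose P) x
      = W_down *v (transpose P *v (\<chi> i. h $ p i))"
    by (simp only: swiglu_def matrix_vector_mul_assoc)
  also have "\<dots> = W_down *v h"
    unfolding P transpose_permutation_matrix_vector_mult[OF p] ..
  finally show "swiglu \<sigma> (P ** W_gate) (P ** W_up) (W_down ** transpose P) x
      = swiglu \<sigma> W_gate W_up W_down x"
    by (simp add: swiglu_def h_def)
qed

end
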